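(* For properties $X,Y$ of subsets of $\mathbb{N}$, write $X\Rightarrow Y$ if every $A\subseteq\mathbb{N}$ with property $X$ has property $Y$, and $X\not\Rightarrow Y$ if some $A\subseteq\mathbb{N}$ has property $X$ but not property $Y$. Then: (a) A-IP $\Rightarrow$ MAX, but MAX $\not\Rightarrow$ A-IP. (b) M-IP $\not\Rightarrow$ NMAX. (c) M-J $\Rightarrow$ MAX, but MAX $\not\Rightarrow$ M-J. (d) A-pcws $\not\Rightarrow$ MAX. (e) A-pcws $\Rightarrow$ NMAX. (f) A-IP $\not\Rightarrow$ A-pcws.
   Context: $\mathbb{N}$ is the set of positive integers, and $\beta\mathbb{N}$ is the set of all ultrafilters on $\mathbb{N}$. For $A\subseteq\mathbb{N}$, $n\in\mathbb{N}$: $A-n=\{a-n:a\in A,\ a>n\}$, $A\!\uparrow\;=\{n\in\mathbb{N}:(\exists a\in A)\ a\mid n\}$, $n\mathbb{N}=\{nk:k\in\mathbb{N}\}$. For $\mathcal{F},\mathcal{G}\in\beta\mathbb{N}$, $\mathcal{F}\,\widetilde{\mid}\,\mathcal{G}$ ("$\mathcal{G}$ is divisible by $\mathcal{F}$") means that $A\!\uparrow\;\in\mathcal{G}$ for every $A\in\mathcal{F}$. An ultrafilter $\mathcal{F}$ is divisible by $n\in\mathbb{N}$ iff $n\mathbb{N}\in\mathcal{F}$; it is $\mathbb{N}$-free if it is not divisible by any $n\in\mathbb{N}\setminus\{1\}$. $MAX$ is the set of all $\mathcal{G}\in\beta\mathbb{N}$ such that $\mathcal{F}\,\widetilde{\mid}\,\mathcal{G}$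 for all $\mathcal{F}\in\beta\mathbb{N}$ (equivalently, $\mathcal{G}$ contains every nonempty $A$ with $A=A\!\uparrow$). A set $A\subseteq\mathbb{N}$ is: - A-IP if there is a sequence $\langle x_n:n\in\mathbb{N}\rangle$ in $\mathbb{N}$ such that $\sum_{n\in F}x_n\in A$ for every nonempty finite $F\subseteq\mathbb{N}$; - M-IP if there is a sequence $\langle x_n:n\in\mathbb{N}\rangle$ in $\mathbb{N}$ such that $\prod_{n\in F}x_n\in A$ for every nonempty finite $F\subseteq\mathbb{N}$; - A-pcws (additively piecewise syndetic) if there is a finite $F\subseteq\mathbb{N}$ such that the family $\{(\bigcup_{t\in F}(A-t))-n:n\in\mathbb{N}\}$ has the finite intersection property; - M-J if for any finite set $\Phi$ of functions from $\mathbb{N}$ to $\mathbb{N}$ there are $a\in\mathbb{N}$ and a nonempty finite $H\subseteq\mathbb{N}$ such that $a\cdot\prod_{i\in H}f(i)\in A$ for all $f\in\Phi$; - MAX (a MAX-set) if it is a member of some ultrafilter in $MAX$; - NMAX (an NMAX-set) if it is a member of some ultrafilter that is $\widetilde{\mid}$-divisible by all $\mathbb{N}$-free ultrafilters. *)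

theory Defs
  imports Complex_Main "HOL-Library.FuncSet"
begin

text \<open>
  The paper's set of natural numbers consists of the \<^emph>\<open>positive\<close> integers only; it is
  rendered as a subset of the type \<^typ>\<open>nat\<close>.
\<close>

abbreviation Npos :: "nat set" (\<open>\<nat>\<^sub>+\<close>)
  where "\<nat>\<^sub>+ \<equiv> {0<..}"

text \<open>
  Ultrafilters on \<open>\<nat>\<^sub>+\<close> are library filters on \<^typ>\<open>nat\<close> that contain \<open>\<nat>\<^sub>+\<close>;
  the set \<open>A\<close> is a member of \<open>F\<close> iff \<open>n \<in> A\<close> holds eventually along \<open>F\<close>.
\<close>

definition fmem :: "'a set \<Rightarrow> 'a filter \<Rightarrow> bool" (infix \<open>\<in>\<^sub>F\<close> 50)
  where "A \<in>\<^sub>F F \<longleftrightarrow> eventually (\<lambda>n. n \<in> A) F"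

definition betaN :: "nat filter set"
  where "betaN = {F. F \<noteq> bot \<and> \<nat>\<^sub>+ \<in>\<^sub>F F \<and> (\<forall>A\<subseteq>\<nat>\<^sub>+. A \<in>\<^sub>F F \<or> (\<nat>\<^sub>+ - A) \<in>\<^sub>F F)}"

definition shift :: "nat set \<Rightarrow> nat \<Rightarrow> nat set"
  where "shift A n = {a - n | a. a \<in> A \<and> a > n}"

definition up :: "nat set \<Rightarrow> nat set"
  where "up A = {n \<in> \<nat>\<^sub>+. \<exists>a\<in>A. a dvd n}"

definition multiples :: "nat \<Rightarrow> nat set"
  where "multiples n = {n * k | k. k \<in> \<nat>\<^sub>+}"

definition tdvd :: "nat filter \<Rightarrow> nat filter \<Rightarrow> bool"
  where "tdvd F G \<longleftrightarrow> (\<forall>A\<subseteq>\<nat>\<^sub>+. A \<in>\<^sub>F F \<longrightarrow> up A \<in>\<^sub>F G)"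

definition divisible_by :: "nat filter \<Rightarrow> nat \<Rightarrow> bool"
  where "divisible_by F n \<longleftrightarrow> multiples n \<in>\<^sub>F F"

definition N_free :: "nat filter \<Rightarrow> bool"
  where "N_free F \<longleftrightarrow> (\<forall>n\<in>\<nat>\<^sub>+ - {1}. \<not> divisible_by F n)"

definition MAX_uf :: "nat filter set"
  where "MAX_uf = {G \<in> betaN. \<forall>F\<in>betaN. tdvd F G}"

definition NMAX_uf :: "nat filter set"
  where "NMAX_uf = {G \<in> betaN. \<forall>F\<in>betaN. N_free F \<longrightarrow> tdvd F G}"

definition A_IP :: "nat set \<Rightarrow> bool"
  where "A_IP A \<longleftrightarrow> (\<exists>x \<in> \<nat>\<^sub>+ \<rightarrow> \<nat>\<^sub>+. \<forall>F\<subseteq>\<nat>\<^sub>+. finite F \<longrightarrow> F \<noteq> {} \<longrightarrow> (\<Sum>n\<in>F. x n) \<in> A)"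

text \<open>The sequence need not be injective; in particular it may be constantly 1.\<close>

definition M_IP :: "nat set \<Rightarrow> bool"
  where "M_IP A \<longleftrightarrow> (\<exists>x \<in> \<nat>\<^sub>+ \<rightarrow> \<nat>\<^sub>+. \<forall>F\<subseteq>\<nat>\<^sub>+. finite F \<longrightarrow> F \<noteq> {} \<longrightarrow> (\<Prod>n\<in>F. x n) \<in> A)"

definition has_fip :: "'a set set \<Rightarrow> bool"
  where "has_fip \<C> \<longleftrightarrow> (\<forall>\<F>\<subseteq>\<C>. finite \<F> \<longrightarrow> \<F> \<noteq> {} \<longrightarrow> \<Inter>\<F> \<noteq> {})"

definition A_pcws :: "nat set \<Rightarrow> bool"
  where "A_pcws A \<longleftrightarrow>
    (\<exists>F\<subseteq>\<nat>\<^sub>+. finite F \<and> has_fip {shift (\<Union>t\<in>F. shift A t) n | n. n \<in> \<nat>\<^sub>+})"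

text \<open>
  The extensional function space makes \<open>\<Phi>\<close> range over sets of functions with domain
  \<open>\<nat>\<^sub>+\<close>, without a spurious value at 0 that could make such a set infinite.
\<close>

definition M_J :: "nat set \<Rightarrow> bool"
  where "M_J A \<longleftrightarrow>
    (\<forall>\<Phi> \<subseteq> \<nat>\<^sub>+ \<rightarrow>\<^sub>E \<nat>\<^sub>+. finite \<Phi> \<longrightarrow>
      (\<exists>a\<in>\<nat>\<^sub>+. \<exists>H\<subseteq>\<nat>\<^sub>+. finite H \<and> H \<noteq> {} \<and> (\<forall>f\<in>\<Phi>. a * (\<Prod>i\<in>H. f i) \<in> A)))"

definition MAX_set :: "nat set \<Rightarrow> bool"
  where "MAX_set A \<longleftrightarrow> (\<exists>G\<in>MAX_uf. A \<in>\<^sub>F G)"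

definition NMAX_set :: "nat set \<Rightarrow> bool"
  where "NMAX_set A \<longleftrightarrow> (\<exists>G\<in>NMAX_uf. A \<in>\<^sub>F G)"

definition prop_implies :: "(nat set \<Rightarrow> bool) \<Rightarrow> (nat set \<Rightarrow> bool) \<Rightarrow> bool" (infix \<open>implies\<close> 50)
  where "X implies Y \<longleftrightarrow> (\<forall>A\<subseteq>\<nat>\<^sub>+. X A \<longrightarrow> Y A)"

definition prop_not_implies :: "(nat set \<Rightarrow> bool) \<Rightarrow> (nat set \<Rightarrow> bool) \<Rightarrow> bool" (infix \<open>not'_implies\<close> 50)
  where "X not_implies Y \<longleftrightarrow> (\<exists>A\<subseteq>\<nat>\<^sub>+. X A \<and> \<not> Y A)"

end

theory Submission
  imports Defs "HOL-Number_Theory.Cong"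
begin

text \<open>
  Both ultrafilter notions reduce to elementary divisibility. Since principal ultrafilters are
  among those that a MAX ultrafilter must be divisible by, and every nonempty upward closed set
  contains some \<open>multiples n\<close>, a set is a MAX-set iff it contains a multiple of every positive
  integer (\<open>MAX_set_iff\<close>). Likewise, the sets that belong to some \<open>\<nat>\<close>-free ultrafilter are those
  that contain, for every \<open>k\<close>, an element coprime to \<open>k\<close>; hence a set is an NMAX-set iff for
  any finitely many such coprime-rich sets it contains one number that has a divisor in each of
  them (\<open>NMAX_set_iff\<close>).
  
  After this translation the positive implications are short. For an A-IP set, two of the first
  partial sums of the sequence agree modulo \<open>n\<close>, and their difference is again a finite sum of the
  sequence. For an M-J set, the constant function \<open>n\<close> yields an element divisible by \<open>n\<close>. For
  an additively piecewise syndetic set \<open>A\<close> there is a \<open>T\<close> and there are arbitrarily long intervals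
  in which every window of length \<open>T\<close> meets \<open>A\<close>. By the Chinese remainder theorem there is a
  residue class such that for each \<open>y\<close> in it all of \<open>y + 1, \<dots>, y + T\<close> have divisors in all given
  coprime-rich sets (\<open>simultaneous_translates_divisible\<close>). A long enough interval contains such a
  \<open>y\<close>, and one of these \<open>T\<close> numbers lies in \<open>A\<close>.
  
  The counterexamples are the following. The numbers \<open>3 ^ n * fact n\<close> include a multiple of every
  positive integer, but each is a multiple of three times any smaller one. So this set contains no
  \<open>x\<close> and \<open>y\<close> together with \<open>x + y\<close>, and no two different elements have a ratio that is a power
  of 2; it is neither A-IP nor M-J. The set \<open>{1}\<close> is M-IP through the constant sequence 1, and it
  misses the upward closure of \<open>{2..}\<close>. The odd numbers are additively syndetic and contain no
  multiple of 2. Finally, the numbers with all base 4 digits in \<open>{0, 1}\<close> include all finite sums of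
  distinct powers of 4, but have gaps of length at least \<open>4 ^ k\<close> in every interval of length
  \<open>2 * 4 ^ Suc k\<close>.
\<close>

section \<open>Ultrafilters from families with the finite intersection property\<close>

lemma fmem_mono: "A \<in>\<^sub>F F \<Longrightarrow> A \<subseteq> B \<Longrightarrow> B \<in>\<^sub>F F"
  unfolding fmem_def by (auto elim: eventually_mono)

lemma fmem_Int: "A \<in>\<^sub>F F \<Longrightarrow> B \<in>\<^sub>F F \<Longrightarrow> A \<inter> B \<in>\<^sub>F F"
  unfolding fmem_def by (auto intro: eventually_conj)

lemma fmem_INT:
  assumes "finite I" and "\<And>i. i \<in> I \<Longrightarrow> S i \<in>\<^sub>F F"
  shows "(\<Inter>i\<in>I. S i) \<in>\<^sub>F F"
  using assms by (simp add: fmem_def eventually_ball_finite_distrib)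

lemma fmem_imp_nonempty: "A \<in>\<^sub>F F \<Longrightarrow> F \<in> betaN \<Longrightarrow> A \<noteq> {}"
  by (auto simp: fmem_def betaN_def)

text \<open>
  A minimal proper filter \<open>G\<close> below \<open>F\<close> exists by Zorn's lemma: the infimum of a chain of proper
  filters is proper, because an event holds along the infimum only if it holds along some member.
  It decides every set \<open>A\<close>, because the restriction of \<open>G\<close> to \<open>A\<close> is either improper or, by
  minimality, \<open>G\<close> itself.
\<close>

lemma proper_filter_extends_to_betaN:
  assumes "F \<noteq> bot" and "\<nat>\<^sub>+ \<in>\<^sub>F F"
  shows "\<exists>G\<in>betaN. G \<le> F"
proof -
  let ?P = "{G. G \<noteq> bot \<and> G \<le> F}"
  have "\<exists>m\<in>?P. \<forall>G\<in>?P. m \<ge> G \<longrightarrow> G = m"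
  proof (rule predicate_Zorn)
    show "partial_order_on ?P (relation_of (\<ge>) ?P)"
      by (rule partial_order_on_relation_ofI) auto
  next
    fix C assume "C \<in> Chains (relation_of (\<ge>) ?P)"
    then have sub: "C \<subseteq> ?P" and lin: "\<And>G H. G \<in> C \<Longrightarrow> H \<in> C \<Longrightarrow> G \<le> H \<or> H \<le> G"
      unfolding Chains_def relation_of_def by auto
    show "\<exists>u\<in>?P. \<forall>G\<in>C. G \<ge> u"
    proof (cases "C = {}")
      case True
      then show ?thesis using assms by auto
    next
      case False
      have "eventually P (Inf C) \<longleftrightarrow> (\<exists>G\<in>C. eventually P G)" for P
        using False lin by (intro eventually_Inf_base) (metis inf.absorb_iff1 inf.absorb_iff2 order_refl)+
      then have "Inf C \<noteq> bot"
        using sub by (auto simp: trivial_limit_def)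
      moreover have "Inf C \<le> F"
        using False sub by (auto intro: Inf_lower2)
      ultimately show ?thesis by (auto intro: Inf_lower)
    qed
  qed
  then obtain G where G: "G \<noteq> bot" "G \<le> F" and minimal: "\<And>H. H \<noteq> bot \<Longrightarrow> H \<le> F \<Longrightarrow> H \<le> G \<Longrightarrow> H = G"
    by blast
  have "\<nat>\<^sub>+ \<in>\<^sub>F G"
    using assms(2) G(2) by (auto simp: fmem_def le_filter_def)
  moreover have "A \<in>\<^sub>F G \<or> \<nat>\<^sub>+ - A \<in>\<^sub>F G" for A
  proof (cases "inf G (principal A) = bot")
    case True
    then have "eventually (\<lambda>n. n \<notin> A) G"
      by (auto simp: trivial_limit_def eventually_inf_principal)
    with \<open>\<nat>\<^sub>+ \<in>\<^sub>F G\<close> have "\<nat>\<^sub>+ - A \<in>\<^sub>F G"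
      unfolding fmem_def by (auto elim: eventually_elim2)
    then show ?thesis ..
  next
    case False
    then have "inf G (principal A) = G"
      using G(2) by (intro minimal) (auto intro: le_infI1)
    moreover have "A \<in>\<^sub>F inf G (principal A)"
      by (simp add: fmem_def eventually_inf_principal)
    ultimately have "A \<in>\<^sub>F G"
      by simp
    then show ?thesis ..
  qed
  ultimately show ?thesis
    using G by (auto simp: betaN_def)
qed

text \<open>
  The set \<open>A\<close> is kept apart from the family because it is the set whose membership is sought,
  while \<open>\<C>\<close> encodes the divisibility that the ultrafilter must have.
\<close>

lemma fip_extends_to_betaN:
  assumes "A \<subseteq> \<nat>\<^sub>+"
    and fip: "\<And>\<X>. finite \<X> \<Longrightarrow> \<X> \<subseteq> \<C> \<Longrightarrow> A \<inter> \<Inter>\<X> \<noteq> {}"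
  shows "\<exists>G\<in>betaN. A \<in>\<^sub>F G \<and> (\<forall>S\<in>\<C>. S \<in>\<^sub>F G)"
proof -
  define F where "F = (INF S\<in>\<C>. principal (A \<inter> S))"
  define H where "H = inf (principal A) F"
  have "(INF S\<in>insert A \<C>. principal (A \<inter> S)) \<noteq> bot"
  proof (rule INF_filter_not_bot)
    fix \<X> assume *: "\<X> \<subseteq> insert A \<C>" "finite \<X>"
    then have "A \<inter> \<Inter>(\<X> - {A}) \<noteq> {}"
      by (intro fip) auto
    then show "(INF S\<in>\<X>. principal (A \<inter> S)) \<noteq> bot"
      using * by (auto simp: INF_principal_finite principal_eq_bot_iff)
  qed
  then have "H \<noteq> bot"
    by (simp add: H_def F_def)
  have "A \<in>\<^sub>F H"
    unfolding H_def fmem_def by (simp add: eventually_inf_principal inf_commute)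
  then have "\<nat>\<^sub>+ \<in>\<^sub>F H"
    using assms(1) by (rule fmem_mono)
  with \<open>H \<noteq> bot\<close> obtain G where G: "G \<in> betaN" "G \<le> H"
    using proper_filter_extends_to_betaN by blast
  have "S \<in>\<^sub>F G" if "S \<in> \<C>" for S
  proof -
    have "G \<le> principal (A \<inter> S)"
      using G(2) that unfolding H_def F_def by (meson INF_lower inf.boundedE order_trans)
    then show ?thesis
      by (auto simp: fmem_def le_principal elim: eventually_mono)
  qed
  moreover have "A \<in>\<^sub>F G"
    using G(2) \<open>A \<in>\<^sub>F H\<close> by (auto simp: fmem_def le_filter_def)
  ultimately show ?thesis using G(1) by blast
qed

section \<open>Combinatorial descriptions of MAX-sets and NMAX-sets\<close>

lemma mem_multiples: "n \<in> \<nat>\<^sub>+ \<Longrightarrow> a \<in> multiples n \<longleftrightarrow> a \<in> \<nat>\<^sub>+ \<and> n dvd a"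
  by (auto simp: multiples_def dvd_def)

lemma multiples_subset_up: "a \<in> A \<Longrightarrow> a \<in> \<nat>\<^sub>+ \<Longrightarrow> multiples a \<subseteq> up A"
  by (auto simp: mem_multiples up_def)

lemma principal_in_betaN: "n \<in> \<nat>\<^sub>+ \<Longrightarrow> principal {n} \<in> betaN"
  by (auto simp: betaN_def fmem_def eventually_principal principal_eq_bot_iff)

text \<open>
  The product of finitely many positive integers is a multiple of each of them. A set with
  multiples of all \<open>n\<close> therefore meets all finite intersections of sets \<open>multiples n\<close>, and an
  ultrafilter that contains all \<open>multiples n\<close> contains every nonempty upward closed set.
\<close>

lemma MAX_set_iff:
  assumes "A \<subseteq> \<nat>\<^sub>+"
  shows "MAX_set A \<longleftrightarrow> (\<forall>n\<in>\<nat>\<^sub>+. \<exists>a\<in>A. n dvd a)"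
proof
  assume "MAX_set A"
  then obtain G where G: "G \<in> MAX_uf" "A \<in>\<^sub>F G"
    by (auto simp: MAX_set_def)
  show "\<forall>n\<in>\<nat>\<^sub>+. \<exists>a\<in>A. n dvd a"
  proof
    fix n :: nat assume n: "n \<in> \<nat>\<^sub>+"
    have "tdvd (principal {n}) G"
      using G(1) principal_in_betaN[OF n] by (auto simp: MAX_uf_def)
    then have "up {n} \<in>\<^sub>F G"
      using n by (auto simp: tdvd_def fmem_def eventually_principal)
    then have "A \<inter> up {n} \<noteq> {}"
      using G by (intro fmem_imp_nonempty[of _ G] fmem_Int) (auto simp: MAX_uf_def)
    then show "\<exists>a\<in>A. n dvd a"
      by (auto simp: up_def)
  qed
next
  assume div: "\<forall>n\<in>\<nat>\<^sub>+. \<exists>a\<in>A. n dvd a"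
  have fip: "A \<inter> \<Inter>\<X> \<noteq> {}" if fin: "finite \<X>" and sub: "\<X> \<subseteq> multiples ` \<nat>\<^sub>+" for \<X>
  proof -
    obtain N where N: "N \<subseteq> \<nat>\<^sub>+" "finite N" "\<X> = multiples ` N"
      using finite_subset_image[OF fin sub] by blast
    have "\<Prod>N \<in> \<nat>\<^sub>+"
      using N by (auto intro!: prod_pos)
    then obtain a where a: "a \<in> A" "\<Prod>N dvd a"
      using div by blast
    have "n dvd a" if "n \<in> N" for n
      using N(2) that a(2) dvd_trans dvd_prodI[of N n "\<lambda>n. n"] by blast
    then have "a \<in> multiples n" if "n \<in> N" for n
      using N(1) a(1) assms that by (subst mem_multiples) auto
    then have "a \<in> \<Inter>\<X>"
      using N(3) by blast
    with a(1) show ?thesis by blast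
  qed
  have "\<exists>G\<in>betaN. A \<in>\<^sub>F G \<and> (\<forall>S\<in>multiples ` \<nat>\<^sub>+. S \<in>\<^sub>F G)"
    by (rule fip_extends_to_betaN[OF assms]) (rule fip)
  then obtain G where G: "G \<in> betaN" "A \<in>\<^sub>F G" and mult: "\<forall>S\<in>multiples ` \<nat>\<^sub>+. S \<in>\<^sub>F G"
    by blast
  have "tdvd F G" if F: "F \<in> betaN" for F
    unfolding tdvd_def
  proof (intro allI impI)
    fix B assume B: "B \<subseteq> \<nat>\<^sub>+" "B \<in>\<^sub>F F"
    then obtain b where "b \<in> B"
      using fmem_imp_nonempty[OF _ F] by blast
    then show "up B \<in>\<^sub>F G"
      using B(1) mult multiples_subset_up[of b B] by (auto intro: fmem_mono)
  qed
  with G show "MAX_set A"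
    by (auto simp: MAX_set_def MAX_uf_def)
qed

definition coprime_rich :: "nat set \<Rightarrow> bool"
  where "coprime_rich B \<longleftrightarrow> (\<forall>k\<in>\<nat>\<^sub>+. \<exists>b\<in>B. coprime b k)"

text \<open>
  If an \<open>\<nat>\<close>-free ultrafilter contains \<open>B\<close>, it also contains the complements of the
  \<open>multiples n\<close> for \<open>2 \<le> n \<le> k\<close>. So some \<open>b\<close> in \<open>B\<close> has no divisor in that range; but \<open>gcd b k\<close> is a
  divisor of \<open>b\<close> that is at most \<open>k\<close>, hence it is 1. Conversely, an element coprime to a product
  of integers greater than 1 is a multiple of none of them.
\<close>

lemma coprime_rich_iff_N_free:
  assumes "B \<subseteq> \<nat>\<^sub>+"
  shows "coprime_rich B \<longleftrightarrow> (\<exists>F\<in>betaN. N_free F \<and> B \<in>\<^sub>F F)"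
proof
  assume rich: "coprime_rich B"
  let ?S = "\<lambda>n. \<nat>\<^sub>+ - multiples n"
  have fip: "B \<inter> \<Inter>\<X> \<noteq> {}" if fin: "finite \<X>" and sub: "\<X> \<subseteq> ?S ` (\<nat>\<^sub>+ - {1})" for \<X>
  proof -
    obtain N where N: "N \<subseteq> \<nat>\<^sub>+ - {1}" "finite N" "\<X> = ?S ` N"
      using finite_subset_image[OF fin sub] by blast
    have "\<Prod>N \<in> \<nat>\<^sub>+"
      using N by (auto intro!: prod_pos)
    then obtain b where b: "b \<in> B" "coprime b (\<Prod>N)"
      using rich by (auto simp: coprime_rich_def)
    have "\<not> n dvd b" if "n \<in> N" for n
      using N that b(2) dvd_prodI[of N n "\<lambda>n. n"] coprime_common_divisor[of b "\<Prod>N" n] by auto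
    then have "b \<in> \<nat>\<^sub>+ - multiples n" if "n \<in> N" for n
      using N(1) b(1) assms mem_multiples[of n b] that by auto
    then have "b \<in> \<Inter>\<X>"
      using N(3) by blast
    with b(1) show ?thesis by blast
  qed
  have "\<exists>F\<in>betaN. B \<in>\<^sub>F F \<and> (\<forall>S\<in>?S ` (\<nat>\<^sub>+ - {1}). S \<in>\<^sub>F F)"
    by (rule fip_extends_to_betaN[OF assms]) (rule fip)
  then obtain F where F: "F \<in> betaN" "B \<in>\<^sub>F F" and S: "\<forall>S\<in>?S ` (\<nat>\<^sub>+ - {1}). S \<in>\<^sub>F F"
    by blast
  have "N_free F"
    unfolding N_free_def divisible_by_def
  proof (intro ballI notI)
    fix n assume "n \<in> \<nat>\<^sub>+ - {1::nat}" "multiples n \<in>\<^sub>F F"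
    then have "multiples n \<inter> ?S n \<in>\<^sub>F F"
      using S by (intro fmem_Int) auto
    then show False
      using fmem_imp_nonempty[OF _ F(1)] by blast
  qed
  with F show "\<exists>F\<in>betaN. N_free F \<and> B \<in>\<^sub>F F" by blast
next
  assume "\<exists>F\<in>betaN. N_free F \<and> B \<in>\<^sub>F F"
  then obtain F where F: "F \<in> betaN" "N_free F" "B \<in>\<^sub>F F" by blast
  show "coprime_rich B"
    unfolding coprime_rich_def
  proof
    fix k :: nat assume k: "k \<in> \<nat>\<^sub>+"
    have "\<nat>\<^sub>+ - multiples n \<in>\<^sub>F F" if "n \<in> {2..k}" for n
    proof -
      have "multiples n \<subseteq> \<nat>\<^sub>+" "\<not> multiples n \<in>\<^sub>F F"
        using that F(2) by (auto simp: mem_multiples N_free_def divisible_by_def)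
      then show ?thesis
        using F(1) by (auto simp: betaN_def)
    qed
    then have "B \<inter> (\<Inter>n\<in>{2..k}. \<nat>\<^sub>+ - multiples n) \<in>\<^sub>F F"
      by (intro fmem_Int F fmem_INT) auto
    then obtain b where b: "b \<in> B" "\<And>n. n \<in> {2..k} \<Longrightarrow> b \<notin> multiples n"
      using fmem_imp_nonempty[OF _ F(1)] by blast
    have "b \<in> multiples (gcd b k)"
      using b(1) assms k by (subst mem_multiples) auto
    then have "gcd b k \<notin> {2..k}"
      using b(2) by blast
    moreover have "gcd b k \<le> k" "gcd b k > 0"
      using k by (auto intro: gcd_le2_nat)
    ultimately have "gcd b k = 1"
      by (metis One_nat_def Suc_leI atLeastAtMost_iff le_antisym not_less_eq_eq numeral_2_eq_2)
    then show "\<exists>b\<in>B. coprime b k"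
      using b(1) coprime_iff_gcd_eq_1 by blast
  qed
qed

lemma NMAX_set_iff:
  assumes "A \<subseteq> \<nat>\<^sub>+"
  shows "NMAX_set A \<longleftrightarrow>
    (\<forall>\<B>. finite \<B> \<longrightarrow> (\<forall>B\<in>\<B>. B \<subseteq> \<nat>\<^sub>+ \<and> coprime_rich B) \<longrightarrow> A \<inter> (\<Inter>B\<in>\<B>. up B) \<noteq> {})"
    (is "_ \<longleftrightarrow> ?fip")
proof
  assume "NMAX_set A"
  then obtain G where G: "G \<in> NMAX_uf" "A \<in>\<^sub>F G"
    by (auto simp: NMAX_set_def)
  show ?fip
  proof (intro allI impI)
    fix \<B> :: "nat set set" assume \<B>: "finite \<B>" "\<forall>B\<in>\<B>. B \<subseteq> \<nat>\<^sub>+ \<and> coprime_rich B"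
    have "up B \<in>\<^sub>F G" if "B \<in> \<B>" for B
      using \<B>(2) that coprime_rich_iff_N_free[of B] G(1) by (auto simp: NMAX_uf_def tdvd_def)
    then have "A \<inter> (\<Inter>B\<in>\<B>. up B) \<in>\<^sub>F G"
      using \<B>(1) by (intro fmem_Int G fmem_INT) auto
    then show "A \<inter> (\<Inter>B\<in>\<B>. up B) \<noteq> {}"
      using G(1) by (intro fmem_imp_nonempty) (auto simp: NMAX_uf_def)
  qed
next
  assume fip: ?fip
  let ?R = "{B. B \<subseteq> \<nat>\<^sub>+ \<and> coprime_rich B}"
  have up_fip: "A \<inter> \<Inter>\<X> \<noteq> {}" if fin: "finite \<X>" and sub: "\<X> \<subseteq> up ` ?R" for \<X>
  proof -
    obtain \<B> where "\<B> \<subseteq> ?R" "finite \<B>" "\<X> = up ` \<B>"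
      using finite_subset_image[OF fin sub] by blast
    then show ?thesis
      using fip[rule_format, of \<B>] by blast
  qed
  have "\<exists>G\<in>betaN. A \<in>\<^sub>F G \<and> (\<forall>S\<in>up ` ?R. S \<in>\<^sub>F G)"
    by (rule fip_extends_to_betaN[OF assms]) (rule up_fip)
  then obtain G where G: "G \<in> betaN" "A \<in>\<^sub>F G" and R: "\<forall>S\<in>up ` ?R. S \<in>\<^sub>F G"
    by blast
  have "tdvd F G" if "F \<in> betaN" "N_free F" for F
    using that R coprime_rich_iff_N_free by (auto simp: tdvd_def)
  with G show "NMAX_set A"
    by (auto simp: NMAX_set_def NMAX_uf_def)
qed

section \<open>Additively piecewise syndetic sets\<close>

text \<open>
  The bound \<open>T\<close> is the largest of the finitely many translations, and the finite intersection
  property for the shifts by \<open>1, \<dots>, L\<close> yields the point \<open>x\<close> before the interval.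
\<close>

lemma A_pcws_imp_intervals:
  assumes "A_pcws A"
  shows "\<exists>T. \<forall>L. \<exists>x. \<forall>n\<in>{1..L}. \<exists>t\<in>{1..T}. x + n + t \<in> A"
proof -
  obtain F where F: "F \<subseteq> \<nat>\<^sub>+" "finite F"
    and fip: "has_fip {shift (\<Union>t\<in>F. shift A t) n | n. n \<in> \<nat>\<^sub>+}"
    using assms by (auto simp: A_pcws_def)
  have "\<exists>x. \<forall>n\<in>{1..L}. \<exists>t\<in>{1..Max F}. x + n + t \<in> A" for L
  proof (cases "L = 0")
    case False
    let ?X = "(\<lambda>n. shift (\<Union>t\<in>F. shift A t) n) ` {1..L}"
    have "?X \<subseteq> {shift (\<Union>t\<in>F. shift A t) n | n. n \<in> \<nat>\<^sub>+}"
      by (fastforce simp: Suc_le_eq)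
    moreover have "finite ?X" "?X \<noteq> {}"
      using False by auto
    ultimately have "\<Inter>?X \<noteq> {}"
      using fip unfolding has_fip_def by blast
    then obtain x where x: "\<And>n. n \<in> {1..L} \<Longrightarrow> x \<in> shift (\<Union>t\<in>F. shift A t) n"
      by blast
    have "\<exists>t\<in>{1..Max F}. x + n + t \<in> A" if n: "n \<in> {1..L}" for n
    proof -
      obtain t where "t \<in> F" "x + n + t \<in> A"
        using x[OF n] by (auto simp: shift_def)
      then show ?thesis
        using F by (intro bexI[of _ t]) auto
    qed
    then show ?thesis by blast
  qed auto
  then show ?thesis by blast
qed

text \<open>
  One more translate \<open>Suc T\<close> is handled by one more congruence. Each \<open>B\<close> has an element coprime to
  the modulus \<open>M\<close> reached so far; the product \<open>m\<close> of these elements is still coprime to \<open>M\<close>, so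
  that the requirement \<open>y = - Suc T\<close> modulo \<open>m\<close> is compatible with the earlier one modulo \<open>M\<close>.
\<close>

lemma simultaneous_translates_divisible:
  assumes "finite \<B>" and \<B>: "\<And>B. B \<in> \<B> \<Longrightarrow> B \<subseteq> \<nat>\<^sub>+ \<and> coprime_rich B"
  shows "\<exists>M\<in>\<nat>\<^sub>+. \<exists>x. \<forall>y. [y = x] (mod M) \<longrightarrow> (\<forall>t\<in>{1..T}. \<forall>B\<in>\<B>. y + t \<in> up B)"
proof (induction T)
  case 0
  then show ?case by auto
next
  case (Suc T)
  then obtain M x where M: "M \<in> \<nat>\<^sub>+"
    and x: "\<And>y t B. [y = x] (mod M) \<Longrightarrow> t \<in> {1..T} \<Longrightarrow> B \<in> \<B> \<Longrightarrow> y + t \<in> up B"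
    by blast
  have "\<forall>B\<in>\<B>. \<exists>b\<in>B. coprime b M"
    using \<B> M by (auto simp: coprime_rich_def)
  then obtain b where b: "\<And>B. B \<in> \<B> \<Longrightarrow> b B \<in> B \<and> coprime (b B) M"
    by metis
  define m where "m = (\<Prod>B\<in>\<B>. b B)"
  have "m > 0"
    unfolding m_def using b \<B> by (intro prod_pos) fastforce
  have "coprime M m"
    unfolding m_def using b by (intro prod_coprime_right) (auto simp: coprime_commute)
  \<comment> \<open>The residue \<open>m * Suc T - Suc T\<close> represents \<open>- Suc T\<close> modulo \<open>m\<close>.\<close>
  then obtain z where z: "[z = x] (mod M)" "[z = m * Suc T - Suc T] (mod m)"
    using binary_chinese_remainder_nat by blast
  have "y + t \<in> up B" if y: "[y = z] (mod M * m)" and t: "t \<in> {1..Suc T}" and B: "B \<in> \<B>" for y t B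
  proof (cases "t = Suc T")
    case False
    have "[y = x] (mod M)"
      using y z(1) by (meson cong_modulus_mult_nat cong_trans)
    then show ?thesis
      using x False t B by auto
  next
    case True
    have "[y = m * Suc T - Suc T] (mod m)"
      using y z(2) by (metis cong_modulus_mult_nat cong_trans mult.commute)
    then have "[y + Suc T = m * Suc T - Suc T + Suc T] (mod m)"
      by (rule cong_add) simp
    also have "m * Suc T - Suc T + Suc T = m * Suc T"
      using \<open>m > 0\<close> by (intro le_add_diff_inverse2) (metis Suc_leI One_nat_def mult_le_mono1 mult_1)
    finally have "m dvd y + Suc T"
      by (simp add: cong_dvd_iff del: add_Suc_right mult_Suc_right)
    moreover have "b B dvd m"
      unfolding m_def using assms(1) B by (rule dvd_prodI)
    ultimately show ?thesis
      using True b[OF B] by (auto simp: up_def intro: dvd_trans)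
  qed
  moreover have "M * m \<in> \<nat>\<^sub>+"
    using M \<open>m > 0\<close> by simp
  ultimately show ?case by blast
qed

lemma interval_meets_residue_class:
  fixes M :: nat
  assumes "M \<in> \<nat>\<^sub>+"
  shows "\<exists>n\<in>{1..M}. [s + n = r] (mod M)"
proof -
  \<comment> \<open>Modulo \<open>M\<close> this is \<open>r - s\<close>, because \<open>M - 1\<close> acts as \<open>- 1\<close>; the outer \<open>Suc\<close> moves the
    remainders into \<open>{1..M}\<close>.\<close>
  define n where "n = Suc ((r + (M - 1) * Suc s) mod M)"
  have "[n = Suc (r + (M - 1) * Suc s)] (mod M)"
    unfolding n_def cong_def by (rule mod_Suc_eq)
  then have "[s + n = s + Suc (r + (M - 1) * Suc s)] (mod M)"
    by (rule cong_add[OF cong_refl])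
  also have "s + Suc (r + (M - 1) * Suc s) = r + M * Suc s"
    using assms by (cases M) auto
  also have "[r + M * Suc s = r] (mod M)"
    by (simp add: cong_def del: mult_Suc_right)
  finally have "[s + n = r] (mod M)" .
  moreover have "n \<in> {1..M}"
    using assms by (auto simp: n_def Suc_le_eq)
  ultimately show ?thesis by blast
qed

text \<open>
  Among \<open>M\<close> consecutive windows of length \<open>T\<close> that all meet \<open>A\<close>, one starts in the residue class
  modulo \<open>M\<close> where all \<open>T\<close> following numbers have the required divisors.
\<close>

lemma A_pcws_imp_NMAX_set:
  assumes "A \<subseteq> \<nat>\<^sub>+" and "A_pcws A"
  shows "NMAX_set A"
  unfolding NMAX_set_iff[OF assms(1)]
proof (intro allI impI)
  fix \<B> :: "nat set set" assume \<B>: "finite \<B>" "\<forall>B\<in>\<B>. B \<subseteq> \<nat>\<^sub>+ \<and> coprime_rich B"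
  obtain T where T: "\<And>L. \<exists>s. \<forall>n\<in>{1..L}. \<exists>t\<in>{1..T}. s + n + t \<in> A"
    using A_pcws_imp_intervals[OF assms(2)] by blast
  obtain M x where M: "M \<in> \<nat>\<^sub>+"
    and x: "\<And>y t B. [y = x] (mod M) \<Longrightarrow> t \<in> {1..T} \<Longrightarrow> B \<in> \<B> \<Longrightarrow> y + t \<in> up B"
    using simultaneous_translates_divisible[of \<B> T] \<B> by blast
  obtain s where s: "\<And>n. n \<in> {1..M} \<Longrightarrow> \<exists>t\<in>{1..T}. s + n + t \<in> A"
    using T by blast
  obtain n where n: "n \<in> {1..M}" "[s + n = x] (mod M)"
    using interval_meets_residue_class[OF M] by blast
  obtain t where "t \<in> {1..T}" "s + n + t \<in> A"
    using s[OF n(1)] by blast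
  then show "A \<inter> (\<Inter>B\<in>\<B>. up B) \<noteq> {}"
    using x[OF n(2)] by blast
qed

text \<open>
  With the translations 1 and 2 every positive integer is covered, so that 1 lies in all shifts.
\<close>

lemma A_pcws_odd: "A_pcws {n. odd n}"
proof -
  have "x \<in> shift (\<Union>t\<in>{1,2}. shift {n. odd n} t) n" if "x > 0" "n > 0" for x n
  proof -
    obtain t :: nat where t: "t \<in> {1,2}" "odd (x + n + t)"
    proof (cases "odd (x + n)")
      case True
      then show thesis by (intro that[of 2]) auto
    next
      case False
      then show thesis by (intro that[of 1]) auto
    qed
    have "x + n = (x + n + t) - t" "t < x + n + t"
      using that by auto
    then have "x + n \<in> shift {n. odd n} t"
      unfolding shift_def using t(2) by blast
    then have "x + n \<in> (\<Union>t\<in>{1,2}. shift {n. odd n} t)"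
      using t(1) by blast
    moreover have "x = (x + n) - n" "n < x + n"
      using that by auto
    ultimately show ?thesis
      unfolding shift_def[of _ n] by blast
  qed
  then have "\<forall>S\<in>{shift (\<Union>t\<in>{1,2}. shift {n. odd n} t) n | n. n \<in> \<nat>\<^sub>+}. 1 \<in> S"
    by auto
  then have "has_fip {shift (\<Union>t\<in>{1,2}. shift {n. odd n} t) n | n. n \<in> \<nat>\<^sub>+}"
    unfolding has_fip_def by blast
  then show ?thesis
    unfolding A_pcws_def by (intro exI[of _ "{1,2}"]) auto
qed

section \<open>IP sets and J sets\<close>

text \<open>
  The pigeonhole principle applies to the \<open>n + 1\<close> partial sums over \<open>{1..k}\<close>, \<open>0 \<le> k \<le> n\<close>, modulo
  \<open>n\<close>.
\<close>

lemma A_IP_imp_MAX_set: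
  assumes "A \<subseteq> \<nat>\<^sub>+" and "A_IP A"
  shows "MAX_set A"
  unfolding MAX_set_iff[OF assms(1)]
proof
  fix n :: nat assume n: "n \<in> \<nat>\<^sub>+"
  obtain x where x: "\<And>F. F \<subseteq> \<nat>\<^sub>+ \<Longrightarrow> finite F \<Longrightarrow> F \<noteq> {} \<Longrightarrow> (\<Sum>n\<in>F. x n) \<in> A"
    using assms(2) by (auto simp: A_IP_def)
  let ?p = "\<lambda>k. \<Sum>i\<in>{1..k}. x i"
  have "\<not> inj_on (\<lambda>k. ?p k mod n) {0..n}"
  proof
    assume "inj_on (\<lambda>k. ?p k mod n) {0..n}"
    then have "card {0..n} \<le> card {..<n}"
      by (rule card_inj_on_le) (use n in auto)
    then show False by simp
  qed
  then obtain j k where jk: "j < k" "?p j mod n = ?p k mod n"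
    unfolding inj_on_def by (metis linorder_neqE_nat)
  have "?p k = ?p j + (\<Sum>i\<in>{j<..k}. x i)"
    using jk(1) by (subst sum.union_disjoint[symmetric]) (auto intro!: sum.cong)
  then have "n dvd (\<Sum>i\<in>{j<..k}. x i)"
    using jk(2) by (metis add_diff_cancel_left' mod_eq_dvd_iff_nat le_add1)
  moreover have "(\<Sum>i\<in>{j<..k}. x i) \<in> A"
    using jk(1) by (intro x) auto
  ultimately show "\<exists>a\<in>A. n dvd a" by blast
qed

lemma M_J_imp_MAX_set:
  assumes "A \<subseteq> \<nat>\<^sub>+" and "M_J A"
  shows "MAX_set A"
  unfolding MAX_set_iff[OF assms(1)]
proof
  fix n :: nat assume n: "n \<in> \<nat>\<^sub>+"
  let ?f = "\<lambda>i\<in>\<nat>\<^sub>+. n"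
  have "{?f} \<subseteq> \<nat>\<^sub>+ \<rightarrow>\<^sub>E \<nat>\<^sub>+" using n by auto
  then obtain a H where H: "H \<subseteq> \<nat>\<^sub>+" "finite H" "H \<noteq> {}" and a: "a * (\<Prod>i\<in>H. ?f i) \<in> A"
    using assms(2)[unfolded M_J_def, rule_format, of "{?f}"] by auto
  obtain i where "i \<in> H" using H(3) by blast
  then have "?f i dvd (\<Prod>i\<in>H. ?f i)"
    using H(2) by (intro dvd_prodI)
  then have "n dvd a * (\<Prod>i\<in>H. ?f i)"
    using H(1) \<open>i \<in> H\<close> by (auto intro: dvd_mult)
  with a show "\<exists>a\<in>A. n dvd a" by blast
qed

text \<open>
  The factorial supplies a multiple of every integer; the power of 3 makes the ratio of any two
  elements a multiple of 3, which rules out both sums and powers of 2.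
\<close>

definition sparse_divisible :: "nat set"
  where "sparse_divisible = range (\<lambda>n. 3 ^ n * fact n)"

lemma sparse_divisible_pos: "sparse_divisible \<subseteq> \<nat>\<^sub>+"
  by (auto simp: sparse_divisible_def)

lemma sparse_divisible_ratio:
  assumes "a \<in> sparse_divisible" "b \<in> sparse_divisible" "a < b"
  shows "3 * a dvd b"
proof -
  obtain m n where mn: "a = 3 ^ m * fact m" "b = 3 ^ n * fact n"
    using assms by (auto simp: sparse_divisible_def)
  have "m < n"
  proof (rule ccontr)
    assume "\<not> m < n"
    then have "b \<le> a"
      unfolding mn by (intro mult_mono power_increasing fact_mono) auto
    then show False using assms(3) by simp
  qed
  then have "3 ^ Suc m * fact m dvd (3 ^ n * fact n :: nat)"
    by (intro mult_dvd_mono le_imp_power_dvd fact_dvd) auto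
  then show ?thesis by (simp add: mn mult.assoc)
qed

lemma MAX_set_sparse_divisible: "MAX_set sparse_divisible"
  unfolding MAX_set_iff[OF sparse_divisible_pos]
proof
  fix n :: nat assume "n \<in> \<nat>\<^sub>+"
  then have "n dvd 3 ^ n * fact n"
    by (intro dvd_mult dvd_fact) auto
  then show "\<exists>a\<in>sparse_divisible. n dvd a"
    by (auto simp: sparse_divisible_def)
qed

text \<open>
  If \<open>x\<close>, \<open>y\<close> and \<open>x + y\<close> were all in the set, both \<open>3 * x\<close> and \<open>3 * y\<close> would be at most \<open>x + y\<close>.
\<close>

lemma not_A_IP_sparse_divisible: "\<not> A_IP sparse_divisible"
proof
  assume "A_IP sparse_divisible"
  then obtain x where x: "\<And>F. F \<subseteq> \<nat>\<^sub>+ \<Longrightarrow> finite F \<Longrightarrow> F \<noteq> {} \<Longrightarrow> (\<Sum>n\<in>F. x n) \<in> sparse_divisible"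
    by (auto simp: A_IP_def)
  have mem: "x 1 \<in> sparse_divisible" "x 2 \<in> sparse_divisible" "x 1 + x 2 \<in> sparse_divisible"
    using x[of "{1}"] x[of "{2}"] x[of "{1, 2}"] by auto
  then have pos: "x 1 > 0" "x 2 > 0"
    using sparse_divisible_pos by auto
  then have "3 * x 1 dvd x 1 + x 2" "3 * x 2 dvd x 1 + x 2"
    by (intro sparse_divisible_ratio mem; simp)+
  with pos have "3 * x 1 \<le> x 1 + x 2" "3 * x 2 \<le> x 1 + x 2"
    by (auto dest: dvd_imp_le)
  with pos show False by linarith
qed

text \<open>
  The constant functions 1 and 2 would give two elements \<open>a\<close> and \<open>a * 2 ^ h\<close> with \<open>h > 0\<close>, whose
  ratio is not a multiple of 3.
\<close>

lemma not_M_J_sparse_divisible: "\<not> M_J sparse_divisible"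
proof
  assume M_J: "M_J sparse_divisible"
  let ?\<Phi> = "{\<lambda>i\<in>\<nat>\<^sub>+. 1, \<lambda>i\<in>\<nat>\<^sub>+. 2} :: (nat \<Rightarrow> nat) set"
  have "?\<Phi> \<subseteq> \<nat>\<^sub>+ \<rightarrow>\<^sub>E \<nat>\<^sub>+" by auto
  then obtain a H where a: "a > 0" and H: "H \<subseteq> \<nat>\<^sub>+" "finite H" "H \<noteq> {}"
    and mem: "\<forall>f\<in>?\<Phi>. a * (\<Prod>i\<in>H. f i) \<in> sparse_divisible"
    using M_J[unfolded M_J_def, rule_format, of ?\<Phi>] by auto
  have "(\<Prod>i\<in>H. (\<lambda>i\<in>\<nat>\<^sub>+. c) i) = c ^ card H" for c :: nat
    using H(1) by (subst prod.cong[of H H _ "\<lambda>_. c"]) auto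
  with mem have "a \<in> sparse_divisible" "a * 2 ^ card H \<in> sparse_divisible"
    by auto
  moreover have "card H > 0"
    using H by (simp add: card_gt_0_iff)
  then have "a < a * 2 ^ card H"
    using a one_less_power[of "2::nat" "card H"] by simp
  ultimately have "3 * a dvd a * 2 ^ card H"
    by (rule sparse_divisible_ratio)
  then have "3 dvd (2::nat) ^ card H"
    using a by (simp add: mult.commute)
  moreover have "coprime (3::nat) (2 ^ card H)"
    by (simp add: coprime_power_right_iff)
  ultimately show False
    using coprime_common_divisor[of 3 "2 ^ card H" "3::nat"] by auto
qed

lemma M_IP_1: "M_IP {1}"
  unfolding M_IP_def by (intro bexI[of _ "\<lambda>_. 1"]) auto

lemma not_NMAX_set_1: "\<not> NMAX_set {1}"
proof
  assume "NMAX_set {1}"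
  moreover have "coprime_rich {2..}"
    unfolding coprime_rich_def
  proof
    fix k :: nat assume "k \<in> \<nat>\<^sub>+"
    then show "\<exists>b\<in>{2..}. coprime b k"
      by (intro bexI[of _ "Suc k"]) auto
  qed
  ultimately have "{1} \<inter> (\<Inter>B\<in>{{2..}}. up B) \<noteq> {}"
    by (subst (asm) NMAX_set_iff) (auto dest!: spec[of _ "{{2..}}"])
  then show False by (auto simp: up_def)
qed

text \<open>
  The digit of \<open>a\<close> at position \<open>k\<close> in base 4 is 0 or 1 iff \<open>a mod 4 ^ Suc k < 2 * 4 ^ k\<close>.
  This form avoids division and is the one that shows the gaps.
\<close>

definition digits4_01 :: "nat set"
  where "digits4_01 = {a \<in> \<nat>\<^sub>+. \<forall>k. a mod 4 ^ Suc k < 2 * 4 ^ k}"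

text \<open>
  Modulo \<open>4 ^ Suc k\<close> only the summands with exponent at most \<open>k\<close> remain. They sum to at most
  \<open>4 ^ k\<close> plus the sum of those with exponent below \<open>k\<close>, and the latter is less than \<open>4 ^ k\<close>.
\<close>

lemma sum_power4_in_digits4_01:
  assumes "finite F" "F \<noteq> {}"
  shows "(\<Sum>n\<in>F. 4 ^ n) \<in> digits4_01"
proof -
  have low: "(\<Sum>n\<in>F \<inter> {..<k}. 4 ^ n) < (4::nat) ^ k" for k
  proof (induction k)
    case (Suc k)
    have "F \<inter> {..<Suc k} = (if k \<in> F then insert k (F \<inter> {..<k}) else F \<inter> {..<k})"
      by (auto simp: less_Suc_eq)
    then show ?case using Suc by auto
  qed simp
  have "(\<Sum>n\<in>F. 4 ^ n) mod 4 ^ Suc k < 2 * (4::nat) ^ k" for k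
  proof -
    have "(\<Sum>n\<in>F. 4 ^ n) = (\<Sum>n\<in>F \<inter> {..<Suc k}. 4 ^ n) + (\<Sum>n\<in>F - {..<Suc k}. (4::nat) ^ n)"
      using assms(1) by (metis sum.Int_Diff)
    moreover have "4 ^ Suc k dvd (\<Sum>n\<in>F - {..<Suc k}. (4::nat) ^ n)"
      by (intro dvd_sum le_imp_power_dvd) auto
    ultimately have "(\<Sum>n\<in>F. 4 ^ n) mod 4 ^ Suc k = (\<Sum>n\<in>F \<inter> {..<Suc k}. (4::nat) ^ n)"
      using low[of "Suc k"] by (auto simp: dvd_def simp del: power_Suc)
    moreover have "(\<Sum>n\<in>F \<inter> {..<Suc k}. (4::nat) ^ n) \<le> (\<Sum>n\<in>insert k (F \<inter> {..<k}). 4 ^ n)"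
      using assms(1) by (intro sum_mono2) (auto simp: less_Suc_eq)
    moreover have "\<dots> < 2 * 4 ^ k"
      using low[of k] assms(1) by simp
    ultimately show ?thesis by linarith
  qed
  moreover have "(\<Sum>n\<in>F. 4 ^ n) > (0::nat)"
    using assms by (intro sum_pos) auto
  ultimately show ?thesis by (simp add: digits4_01_def)
qed

lemma A_IP_digits4_01: "A_IP digits4_01"
  unfolding A_IP_def
  by (intro bexI[of _ "\<lambda>n. 4 ^ n"]) (auto intro: sum_power4_in_digits4_01)

text \<open>
  Windows of length \<open>T < 4 ^ T\<close> after a number congruent to \<open>2 * 4 ^ T\<close> modulo \<open>4 ^ Suc T\<close> contain
  only numbers whose digit at position \<open>T\<close> is 2, and every interval of length \<open>4 ^ Suc T\<close>
  contains such a starting point.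
\<close>

lemma not_A_pcws_digits4_01: "\<not> A_pcws digits4_01"
proof
  assume "A_pcws digits4_01"
  then obtain T where T: "\<And>L. \<exists>s. \<forall>n\<in>{1..L}. \<exists>t\<in>{1..T}. s + n + t \<in> digits4_01"
    using A_pcws_imp_intervals by blast
  have "T < 4 ^ T" by (induction T) auto
  obtain s where s: "\<And>n. n \<in> {1..4 ^ Suc T} \<Longrightarrow> \<exists>t\<in>{1..T}. s + n + t \<in> digits4_01"
    using T by blast
  obtain n where n: "n \<in> {1..4 ^ Suc T}" "[s + n = 2 * 4 ^ T] (mod 4 ^ Suc T)"
    using interval_meets_residue_class[of "4 ^ Suc T" s "2 * 4 ^ T"] by auto
  obtain t where t: "t \<in> {1..T}" "s + n + t \<in> digits4_01"
    using s[OF n(1)] by blast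
  have "[s + n + t = 2 * 4 ^ T + t] (mod 4 ^ Suc T)"
    using n(2) by (rule cong_add) simp
  then have "(s + n + t) mod 4 ^ Suc T = 2 * 4 ^ T + t"
    using t(1) \<open>T < 4 ^ T\<close> by (simp add: cong_def)
  moreover have "(s + n + t) mod 4 ^ Suc T < 2 * 4 ^ T"
    using t(2) by (simp add: digits4_01_def)
  ultimately show False by simp
qed

theorem theorem5p1:
  shows "(A_IP implies MAX_set \<and> MAX_set not_implies A_IP)
    \<and> M_IP not_implies NMAX_set
    \<and> (M_J implies MAX_set \<and> MAX_set not_implies M_J)
    \<and> A_pcws not_implies MAX_set
    \<and> A_pcws implies NMAX_set
    \<and> A_IP not_implies A_pcws"
proof (intro conjI)
  show "A_IP implies MAX_set"
    using A_IP_imp_MAX_set by (auto simp: prop_implies_def)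
  show "MAX_set not_implies A_IP"
    using sparse_divisible_pos MAX_set_sparse_divisible not_A_IP_sparse_divisible
    by (auto simp: prop_not_implies_def)
  show "M_IP not_implies NMAX_set"
    using M_IP_1 not_NMAX_set_1 by (auto simp: prop_not_implies_def intro!: exI[of _ "{1}"])
  show "M_J implies MAX_set"
    using M_J_imp_MAX_set by (auto simp: prop_implies_def)
  show "MAX_set not_implies M_J"
    using sparse_divisible_pos MAX_set_sparse_divisible not_M_J_sparse_divisible
    by (auto simp: prop_not_implies_def)
  have odd_pos: "{n. odd n} \<subseteq> \<nat>\<^sub>+"
    by (auto simp: odd_pos)
  have "\<not> MAX_set {n. odd n}"
    unfolding MAX_set_iff[OF odd_pos] by (auto intro!: bexI[of _ 2])
  with odd_pos A_pcws_odd show "A_pcws not_implies MAX_set"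
    unfolding prop_not_implies_def by blast
  show "A_pcws implies NMAX_set"
    using A_pcws_imp_NMAX_set by (auto simp: prop_implies_def)
  have "digits4_01 \<subseteq> \<nat>\<^sub>+" by (auto simp: digits4_01_def)
  then show "A_IP not_implies A_pcws"
    using A_IP_digits4_01 not_A_pcws_digits4_01 by (auto simp: prop_not_implies_def)
qed

end
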